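(* For $\tau>0$ let $(\lambda(\tau),u(x,\tau))=\left(\frac{2\tau^2}{\cosh^2\tau},\,2\log\frac{\cosh\tau}{\cosh(\tau x)}\right)$ and let $\{\mu_j\}_{j=1}^{\infty}$, $\mu_1<\mu_2<\cdots$, be the eigenvalues (depending on $\tau$) of the problem $$\varphi''+\lambda(\tau)e^{u(x,\tau)}\varphi=-\mu\varphi\ \ (-1<x<1),\qquad \varphi(-1)=\varphi(1)=0.$$ Then the following hold: (i) For every $j\ge1$, $\displaystyle\lim_{\tau\downarrow0}\sqrt{\mu_j}=\frac{\pi}{2}j$. (ii) $\displaystyle\lim_{\tau\to\infty}\mu_1=-\infty$, and for every $j\ge2$, $\displaystyle\lim_{\tau\to\infty}\sqrt{\mu_j}=\frac{\pi}{2}(j-1)$.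
   Context: The pairs $(\lambda(\tau),u(\cdot,\tau))$, $\tau>0$, are exactly the positive solutions of the one-dimensional Gel'fand problem $u''+\lambda e^u=0$ on $(-1,1)$, $u(\pm1)=0$, with $\lambda>0$; the eigenvalue problem is its linearization at the solution. Primes denote derivatives in $x$. By classical Sturm–Liouville theory all eigenvalues are real and simple and can be listed as a strictly increasing sequence. Let $\tau_1$ be the unique positive solution of $\tau\tanh\tau=1$. One has $\mu_j>0$ for $j\ge2$ and all $\tau>0$, and $\mu_1>0$ for $0<\tau<\tau_1$, so the square roots in the statement make sense. *)

theory Defs
  imports "HOL-Analysis.Analysis"
begin

definition gelfand_lambda :: "real \<Rightarrow> real" where
  "gelfand_lambda \<tau> = 2 * \<tau>\<^sup>2 / (cosh \<tau>)\<^sup>2"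

definition gelfand_u :: "real \<Rightarrow> real \<Rightarrow> real" where
  "gelfand_u \<tau> x = 2 * ln (cosh \<tau> / cosh (\<tau> * x))"

(* Classical solutions: twice differentiable in the open interval and continuous up to the
   boundary. Nontriviality is required on [-1,1], since the values of f elsewhere are irrelevant. *)
definition dirichlet_eigenfunction ::
    "(real \<Rightarrow> real) \<Rightarrow> real \<Rightarrow> (real \<Rightarrow> real) \<Rightarrow> bool" where
  "dirichlet_eigenfunction V m f \<longleftrightarrow>
     continuous_on {-1..1} f \<and>
     (\<exists>f' f''. \<forall>x\<in>{-1<..<1}.
        (f has_real_derivative f' x) (at x) \<and>
        (f' has_real_derivative f'' x) (at x) \<and>
        f'' x + V x * f x = - m * f x) \<and>
     f (-1) = 0 \<and> f 1 = 0 \<and>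
     (\<exists>x\<in>{-1..1}. f x \<noteq> 0)"

definition linearized_eigenvalue :: "real \<Rightarrow> real \<Rightarrow> bool" where
  "linearized_eigenvalue \<tau> m \<longleftrightarrow>
     (\<exists>f. dirichlet_eigenfunction
            (\<lambda>x. gelfand_lambda \<tau> * exp (gelfand_u \<tau> x)) m f)"

(* The indices start at 1; the value m 0 is unconstrained. *)
definition lists_eigenvalues :: "real \<Rightarrow> (nat \<Rightarrow> real) \<Rightarrow> bool" where
  "lists_eigenvalues \<tau> m \<longleftrightarrow>
     strict_mono_on {1..} m \<and> m ` {1..} = {c. linearized_eigenvalue \<tau> c}"

end

theory Submission
  imports Defs
begin

text \<open>
  The potential is $\lambda e^u = 2 (\tau^2 - t^2)$ with $t(x) = \tau \tanh (\tau x)$, the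
  reflectionless potential with a single bound state. Because $t' = \tau^2 - t^2$, the operator
  $\psi \mapsto \psi' - t \psi$ carries solutions of $\psi'' = -m \psi$ to solutions of the
  linearized equation with eigenvalue $m$ (a Darboux transformation). So the general solution is
  elementary and the eigenvalue problem becomes a transcendental equation in $m$ that contains
  $\tau$ only through $a = \tau \tanh \tau$, the value of $t$ at the boundary. As the potential is
  even, $m$ is an eigenvalue iff the even or the odd solution vanishes at $1$
  (\<open>linearized_eigenvalue_iff_off_bound_state\<close>).

  For $m = k^2 > 0$ the even solution gives $k \cos k = a \sin k$ and the odd one
  $k \sin k = - a \cos k$. A shift of the trigonometric argument by $\pi/2$ exchanges the two
  equations. Hence, with $k = n \pi/2 + s$ and $0 < s < \pi/2$, both are the single equation
  $k \cos s = a \sin s$ (\<open>linearized_eigenvalue_positive_iff_band\<close>). It has exactly one root $s$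
  in each band $n \ge 1$, and in the band $n = 0$ exactly one if $a < 1$ and none if $a > 1$. In the
  latter case that eigenvalue has become negative: it is $- \kappa^2$ with
  $\kappa \coth \kappa = a$, which forces $\kappa \ge a - 1$. So for $a \ne 1$ the $j$-th
  eigenvalue is the one in band $j - 1$, with the exception of $- \kappa^2$ for $j = 1$
  (\<open>listing_from_bands\<close>).

  The limits follow because $a \to 0$ as $\tau \to 0$ and $a \to \infty$ as $\tau \to \infty$. The
  band equation gives $\arccos a \le s < \pi/2$, which moves the root to the upper end of its band
  as $a \to 0$, and $0 < s \le ((j - 1) \pi/2 + \pi/2) / a$, which moves it to the lower end as
  $a \to \infty$. Moreover $\mu_1 = - \kappa^2 \le - (a - 1)^2$.
\<close>

section \<open>Even and odd solutions decide the Dirichlet problem\<close>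

text \<open>
  The Wronskians of an eigenfunction $f$ with $p$ and with $q$ are constant on the open interval, so
  $f$ is a combination of $p$ and $q$ there. Since nothing is known about the derivative of $f$ at
  $\pm 1$, this identity reaches the endpoints by continuity of $f$ alone. Parity then decouples the
  two boundary conditions.
\<close>
lemma dirichlet_eigenvalue_iff_basis_vanishes:
  fixes V p p' q q' :: "real \<Rightarrow> real"
  assumes p: "\<And>x. (p has_real_derivative p' x) (at x)"
    and p': "\<And>x. (p' has_real_derivative - (V x + m) * p x) (at x)"
    and q: "\<And>x. (q has_real_derivative q' x) (at x)"
    and q': "\<And>x. (q' has_real_derivative - (V x + m) * q x) (at x)"
    and even: "p (-1) = p 1" and odd: "q (-1) = - q 1"
    and indep: "p 0 * q' 0 - p' 0 * q 0 \<noteq> 0"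
  shows "(\<exists>f. dirichlet_eigenfunction V m f) \<longleftrightarrow> p 1 = 0 \<or> q 1 = 0"
proof -
  define w where "w = p 0 * q' 0 - p' 0 * q 0"
  have "\<exists>c. \<forall>x\<in>UNIV. p x * q' x - p' x * q x = c"
    by (rule has_field_derivative_zero_constant)
      (auto intro!: derivative_eq_intros p p' q q' simp: algebra_simps)
  then have w: "p x * q' x - p' x * q x = w" for x
    unfolding w_def by (metis UNIV_I)
  have cont: "continuous_on S p" "continuous_on S q" for S
    using p q by (meson DERIV_isCont continuous_at_imp_continuous_on)+
  show ?thesis
  proof
    assume "\<exists>f. dirichlet_eigenfunction V m f"
    then obtain f f' f'' where cf: "continuous_on {-1..1} f"
      and f: "\<And>x. x \<in> {-1<..<1} \<Longrightarrow> (f has_real_derivative f' x) (at x)"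
      and f': "\<And>x. x \<in> {-1<..<1} \<Longrightarrow> (f' has_real_derivative f'' x) (at x)"
      and ode: "\<And>x. x \<in> {-1<..<1} \<Longrightarrow> f'' x + V x * f x = - m * f x"
      and bc: "f (-1) = 0" "f 1 = 0" and nz: "\<exists>x\<in>{-1..1}. f x \<noteq> 0"
      unfolding dirichlet_eigenfunction_def by metis
    have f'2: "(f' has_real_derivative - (V x + m) * f x) (at x within {-1<..<1})"
      if "x \<in> {-1<..<1}" for x
    proof -
      have "f'' x = - (V x + m) * f x" using ode[OF that] by (simp add: algebra_simps)
      with f'[OF that] show ?thesis by (simp add: has_field_derivative_at_within)
    qed
    have f2: "(f has_real_derivative f' x) (at x within {-1<..<1})"
      if "x \<in> {-1<..<1}" for x
      using f[OF that] by (rule has_field_derivative_at_within)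
    have wronskian_const: "\<exists>c. \<forall>x\<in>{-1<..<1}. f x * g' x - f' x * g x = c"
      if g: "\<And>x. (g has_real_derivative g' x) (at x)"
        "\<And>x. (g' has_real_derivative - (V x + m) * g x) (at x)" for g g' :: "real \<Rightarrow> real"
    proof (rule has_field_derivative_zero_constant)
      fix x :: real assume x: "x \<in> {-1<..<1}"
      have g2: "(g has_real_derivative g' x) (at x within {-1<..<1})"
        "(g' has_real_derivative - (V x + m) * g x) (at x within {-1<..<1})"
        using g by (auto intro: has_field_derivative_at_within)
      show "((\<lambda>x. f x * g' x - f' x * g x) has_real_derivative 0) (at x within {-1<..<1})"
        by (auto intro!: derivative_eq_intros f2[OF x] f'2[OF x] g2 simp: algebra_simps)
    qed auto
    obtain A where A: "\<And>x. x \<in> {-1<..<1} \<Longrightarrow> f x * p' x - f' x * p x = A"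
      using wronskian_const[OF p p'] by blast
    obtain B where B: "\<And>x. x \<in> {-1<..<1} \<Longrightarrow> f x * q' x - f' x * q x = B"
      using wronskian_const[OF q q'] by blast
    \<comment> \<open>Cramer's rule expresses $f$ in the basis $p, q$ through its Wronskians with them.\<close>
    have "w * f x - (B * p x - A * q x) = 0" if x: "x \<in> {-1<..<1}" for x
      unfolding A[OF x, symmetric] B[OF x, symmetric] w[of x, symmetric]
      by (simp add: algebra_simps)
    then have "w * f x - (B * p x - A * q x) = 0" if "x \<in> {-1..1}" for x
      using that
      by (intro continuous_constant_on_closure
            [of "{-1<..<1}" "\<lambda>x. w * f x - (B * p x - A * q x)" 0 x])
        (auto intro!: continuous_intros cf cont)
    then have comb: "w * f x = B * p x - A * q x" if "x \<in> {-1..1}" for x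
      using that by fastforce
    have "B * p 1 = 0" "A * q 1 = 0"
      using comb[of 1] comb[of "-1"] bc even odd by auto
    moreover have "A \<noteq> 0 \<or> B \<noteq> 0"
      using nz comb indep unfolding w_def by fastforce
    ultimately show "p 1 = 0 \<or> q 1 = 0" by auto
  next
    assume zero: "p 1 = 0 \<or> q 1 = 0"
    have eig: "dirichlet_eigenfunction V m g"
      if g: "\<And>x. (g has_real_derivative g' x) (at x)"
        "\<And>x. (g' has_real_derivative - (V x + m) * g x) (at x)"
        and "g (-1) = 0" "g 1 = 0" "g 0 \<noteq> 0 \<or> g' 0 \<noteq> 0" for g g' :: "real \<Rightarrow> real"
    proof -
      \<comment> \<open>A solution that vanishes on the interval has zero initial data at $0$.\<close>
      have "\<exists>x\<in>{-1..1}. g x \<noteq> 0"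
      proof (rule ccontr)
        assume *: "\<not> ?thesis"
        have "(g has_real_derivative 0) (at 0)"
        proof (rule has_field_derivative_transform_within_open)
          show "((\<lambda>x. 0) has_real_derivative 0) (at (0::real))" by simp
          show "open {-1<..<1::real}" by simp
          show "\<And>x. x \<in> {-1<..<1} \<Longrightarrow> 0 = g x" using * by force
        qed simp
        then have "g' 0 = 0" using g(1) DERIV_unique by blast
        moreover have "g 0 = 0" using * by simp
        ultimately show False using that(5) by simp
      qed
      moreover have "continuous_on {-1..1} g"
        using g(1) by (meson DERIV_isCont continuous_at_imp_continuous_on)
      moreover have "\<forall>x\<in>{-1<..<1}. (g has_real_derivative g' x) (at x) \<and>
          (g' has_real_derivative - (V x + m) * g x) (at x) \<and>
          - (V x + m) * g x + V x * g x = - m * g x"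
        using g by (simp add: algebra_simps)
      ultimately show ?thesis
        unfolding dirichlet_eigenfunction_def using that(3,4)
        by (intro conjI exI[of _ g'] exI[of _ "\<lambda>x. - (V x + m) * g x"])
    qed
    show "\<exists>f. dirichlet_eigenfunction V m f"
      using zero
    proof
      assume "p 1 = 0"
      moreover have "p 0 \<noteq> 0 \<or> p' 0 \<noteq> 0" using indep by auto
      ultimately have "dirichlet_eigenfunction V m p"
        using even by (intro eig[OF p p']) auto
      then show ?thesis by (rule exI[where x = p])
    next
      assume "q 1 = 0"
      moreover have "q 0 \<noteq> 0 \<or> q' 0 \<noteq> 0" using indep by auto
      ultimately have "dirichlet_eigenfunction V m q"
        using odd by (intro eig[OF q q']) auto
      then show ?thesis by (rule exI[where x = q])
    qed
  qed
qed

section \<open>Explicit solutions of the linearized equation\<close>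

lemma one_minus_tanh_square: "1 - (tanh y)\<^sup>2 = 1 / (cosh y)\<^sup>2" for y :: real
  using cosh_real_pos[of y] hyperbolic_pythagoras[of y]
  by (metis diff_divide_distrib div_self less_irrefl power_divide power_not_zero tanh_def)

lemma gelfand_potential:
  "gelfand_lambda \<tau> * exp (gelfand_u \<tau> x) = 2 * (\<tau>\<^sup>2 - (\<tau> * tanh (\<tau> * x))\<^sup>2)"
proof -
  have pos: "cosh y > 0" for y :: real by (rule cosh_real_pos)
  have "exp (gelfand_u \<tau> x) = (cosh \<tau> / cosh (\<tau> * x))\<^sup>2"
    unfolding gelfand_u_def using pos[of \<tau>] pos[of "\<tau> * x"]
    by (simp add: exp_double)
  then have "gelfand_lambda \<tau> * exp (gelfand_u \<tau> x) = 2 * \<tau>\<^sup>2 / (cosh (\<tau> * x))\<^sup>2"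
    unfolding gelfand_lambda_def using pos[of \<tau>] by (simp add: power_divide)
  also have "\<dots> = 2 * \<tau>\<^sup>2 * (1 - (tanh (\<tau> * x))\<^sup>2)"
    by (simp add: one_minus_tanh_square)
  finally show ?thesis by (simp add: power_mult_distrib algebra_simps)
qed

text \<open>
  This Riccati equation is what makes $\psi \mapsto \psi' - t \psi$ a Darboux transformation.
\<close>
lemma riccati_tanh:
  fixes \<tau> x :: real
  shows "((\<lambda>x. \<tau> * tanh (\<tau> * x)) has_real_derivative \<tau>\<^sup>2 - (\<tau> * tanh (\<tau> * x))\<^sup>2) (at x)"
  by (auto intro!: derivative_eq_intros cosh_real_nonzero
      simp: power_mult_distrib algebra_simps power2_eq_square)

text \<open>
  The functions $C$ and $S$ stand for cosine and sine at frequency $\sqrt m$, with $m$ of any sign.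
  Their Darboux transforms are an odd and an even solution, with Wronskian $\pm (m + \tau^2)$. At
  $m = - \tau^2$ the transformation has the kernel $\cosh (\tau x)$, and the two images are dependent.
\<close>
lemma linearized_eigenvalue_iff_off_bound_state:
  fixes C S :: "real \<Rightarrow> real"
  assumes C: "\<And>x. (C has_real_derivative - m * S x) (at x)"
    and S: "\<And>x. (S has_real_derivative C x) (at x)"
    and init: "C 0 = 1" "S 0 = 0"
    and parity: "C (-1) = C 1" "S (-1) = - S 1"
    and m: "m \<noteq> - \<tau>\<^sup>2"
  shows "linearized_eigenvalue \<tau> m \<longleftrightarrow>
           C 1 = \<tau> * tanh \<tau> * S 1 \<or> m * S 1 + \<tau> * tanh \<tau> * C 1 = 0"
proof -
  define V where "V = (\<lambda>x. gelfand_lambda \<tau> * exp (gelfand_u \<tau> x))"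
  define t where "t x = \<tau> * tanh (\<tau> * x)" for x
  have V: "V x = 2 * (\<tau>\<^sup>2 - (t x)\<^sup>2)" for x
    unfolding V_def t_def by (rule gelfand_potential)
  have t: "(t has_real_derivative \<tau>\<^sup>2 - (t x)\<^sup>2) (at x)" for x
    unfolding t_def by (rule riccati_tanh)
  \<comment> \<open>The Darboux transforms of $S$ (even) and of $C$ (odd).\<close>
  define p where "p x = C x - t x * S x" for x
  define p' where "p' x = - m * S x - (\<tau>\<^sup>2 - (t x)\<^sup>2) * S x - t x * C x" for x
  define q where "q x = - m * S x - t x * C x" for x
  define q' where "q' x = - m * C x - (\<tau>\<^sup>2 - (t x)\<^sup>2) * C x + m * t x * S x" for x
  have "(\<exists>f. dirichlet_eigenfunction V m f) \<longleftrightarrow> p 1 = 0 \<or> q 1 = 0"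
  proof (rule dirichlet_eigenvalue_iff_basis_vanishes)
    fix x
    show "(p has_real_derivative p' x) (at x)"
      unfolding p_def p'_def
      by (auto intro!: derivative_eq_intros C S t simp: algebra_simps)
    show "(p' has_real_derivative - (V x + m) * p x) (at x)"
      unfolding p_def p'_def V
      by (auto intro!: derivative_eq_intros C S t simp: algebra_simps power2_eq_square)
    show "(q has_real_derivative q' x) (at x)"
      unfolding q_def q'_def
      by (auto intro!: derivative_eq_intros C S t simp: algebra_simps)
    show "(q' has_real_derivative - (V x + m) * q x) (at x)"
      unfolding q_def q'_def V
      by (auto intro!: derivative_eq_intros C S t simp: algebra_simps power2_eq_square)
  next
    show "p 0 * q' 0 - p' 0 * q 0 \<noteq> 0"
      using m init by (simp add: p_def p'_def q_def q'_def t_def)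
  qed (simp_all add: p_def q_def t_def parity)
  moreover have "p 1 = C 1 - \<tau> * tanh \<tau> * S 1" "q 1 = - (m * S 1 + \<tau> * tanh \<tau> * C 1)"
    by (simp_all add: p_def q_def t_def)
  ultimately show ?thesis
    unfolding linearized_eigenvalue_def V_def[symmetric]
    by (simp only: right_minus_eq neg_equal_0_iff_equal)
qed

text \<open>
  At $m = - \tau^2$ an even solution is the bound state $1 / \cosh (\tau x)$ of the potential on
  the whole line. Reduction of order gives the odd solution
  $\sinh (\tau x) + \tau x / \cosh (\tau x)$, and both are positive at $1$.
\<close>
lemma bound_state_energy_not_eigenvalue:
  assumes "\<tau> > 0"
  shows "\<not> linearized_eigenvalue \<tau> (- \<tau>\<^sup>2)"
proof -
  define V where "V = (\<lambda>x. gelfand_lambda \<tau> * exp (gelfand_u \<tau> x))"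
  define t where "t x = \<tau> * tanh (\<tau> * x)" for x
  have V: "V x = 2 * (\<tau>\<^sup>2 - (t x)\<^sup>2)" for x
    unfolding V_def t_def by (rule gelfand_potential)
  have t: "(t has_real_derivative \<tau>\<^sup>2 - (t x)\<^sup>2) (at x)" for x
    unfolding t_def by (rule riccati_tanh)
  have nz: "cosh y \<noteq> 0" for y :: real by (rule cosh_real_nonzero)
  define p where "p x = 1 / cosh (\<tau> * x)" for x
  have p: "(p has_real_derivative - t x * p x) (at x)" for x
    unfolding p_def t_def
    by (auto intro!: derivative_eq_intros nz simp: tanh_def field_simps power2_eq_square)
  have sinh: "((\<lambda>x. sinh (\<tau> * x)) has_real_derivative \<tau> * cosh (\<tau> * x)) (at x)"
    and cosh: "((\<lambda>x. cosh (\<tau> * x)) has_real_derivative \<tau> * sinh (\<tau> * x)) (at x)" for x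
    by (auto intro!: derivative_eq_intros)
  define q where "q x = sinh (\<tau> * x) + \<tau> * x * p x" for x
  define q' where "q' x = \<tau> * cosh (\<tau> * x) + \<tau> * p x - \<tau> * x * t x * p x" for x
  have sq: "\<tau>\<^sup>2 - (t x)\<^sup>2 = \<tau>\<^sup>2 * (p x)\<^sup>2" for x
  proof -
    have "\<tau>\<^sup>2 - (t x)\<^sup>2 = \<tau>\<^sup>2 * (1 - (tanh (\<tau> * x))\<^sup>2)"
      by (simp add: t_def power_mult_distrib algebra_simps)
    then show ?thesis by (simp add: one_minus_tanh_square p_def power_divide)
  qed
  have "(\<exists>f. dirichlet_eigenfunction V (- \<tau>\<^sup>2) f) \<longleftrightarrow> p 1 = 0 \<or> q 1 = 0"
  proof (rule dirichlet_eigenvalue_iff_basis_vanishes)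
    fix x
    show "(p has_real_derivative - t x * p x) (at x)" by (rule p)
    show "((\<lambda>x. - t x * p x) has_real_derivative - (V x + - \<tau>\<^sup>2) * p x) (at x)"
      unfolding V
      by (auto intro!: derivative_eq_intros p t simp: algebra_simps power2_eq_square)
    show "(q has_real_derivative q' x) (at x)"
      unfolding q_def q'_def
      by (auto intro!: derivative_eq_intros p sinh simp: algebra_simps)
    \<comment> \<open>Both sides are $\tau^2 \sinh (\tau x) / \cosh^2 (\tau x)$. The hyperbolic sine in $q$ does not solve
      the equation by itself, and this identity moves its defect to the other summand.\<close>
    have "(\<tau>\<^sup>2 - (t x)\<^sup>2) * sinh (\<tau> * x) = \<tau> * t x * p x"
      unfolding sq using nz[of "\<tau> * x"]
      by (simp add: p_def t_def tanh_def field_simps power2_eq_square)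
    then have key: "(t x)\<^sup>2 * sinh (\<tau> * x) = \<tau>\<^sup>2 * sinh (\<tau> * x) - \<tau> * t x * p x"
      by (simp add: algebra_simps)
    have val: "\<tau>\<^sup>2 * sinh (\<tau> * x) - 2 * (\<tau> * t x * p x)
             - \<tau> * x * p x * (\<tau>\<^sup>2 - 2 * (t x)\<^sup>2) = - (V x + - \<tau>\<^sup>2) * q x"
      unfolding V q_def using key by (simp add: algebra_simps)
    show "(q' has_real_derivative - (V x + - \<tau>\<^sup>2) * q x) (at x)"
      unfolding q'_def val[symmetric]
      by (auto intro!: derivative_eq_intros p cosh t simp: algebra_simps power2_eq_square)
  next
    show "p (-1) = p 1" "q (-1) = - q 1" by (simp_all add: p_def q_def)
    show "p 0 * q' 0 - - t 0 * p 0 * q 0 \<noteq> 0"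
      using assms by (simp add: p_def q_def q'_def t_def)
  qed
  moreover have "p 1 > 0" "q 1 > 0"
    using assms by (auto simp: p_def q_def intro!: add_pos_pos)
  ultimately show ?thesis
    unfolding linearized_eigenvalue_def V_def[symmetric] by simp
qed

section \<open>The characteristic equations\<close>

lemma linearized_eigenvalue_zero_iff:
  assumes "\<tau> > 0"
  shows "linearized_eigenvalue \<tau> 0 \<longleftrightarrow> \<tau> * tanh \<tau> = 1"
proof -
  have "linearized_eigenvalue \<tau> 0 \<longleftrightarrow> 1 = \<tau> * tanh \<tau> * 1 \<or> 0 * 1 + \<tau> * tanh \<tau> * 1 = 0"
    by (rule linearized_eigenvalue_iff_off_bound_state[where C = "\<lambda>_. 1" and S = "\<lambda>x. x"])
      (use assms in \<open>auto intro!: derivative_eq_intros\<close>)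
  then show ?thesis using assms by auto
qed

text \<open>
  Only even eigenfunctions occur: the odd solution would require
  $\kappa \tanh \kappa = \tau \tanh \tau$, hence $\kappa = \tau$ by monotonicity, and at that value
  the Darboux solutions degenerate.
\<close>
lemma linearized_eigenvalue_negative_iff:
  assumes "\<tau> > 0" "\<kappa> > 0"
  shows "linearized_eigenvalue \<tau> (- \<kappa>\<^sup>2) \<longleftrightarrow> \<kappa> * cosh \<kappa> = \<tau> * tanh \<tau> * sinh \<kappa>"
proof (cases "\<kappa> = \<tau>")
  case True
  have "\<tau> * tanh \<tau> * sinh \<tau> < \<tau> * cosh \<tau>"
  proof -
    have "tanh \<tau> * sinh \<tau> < 1 * cosh \<tau>"
      using assms tanh_real_lt_1[of \<tau>] sinh_less_cosh_real[of \<tau>]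
      by (intro mult_strict_mono) auto
    then show ?thesis using assms by simp
  qed
  then show ?thesis using True bound_state_energy_not_eigenvalue[OF assms(1)] by auto
next
  case False
  have ne: "- \<kappa>\<^sup>2 \<noteq> - \<tau>\<^sup>2" using False assms by (simp add: power2_eq_iff)
  have "linearized_eigenvalue \<tau> (- \<kappa>\<^sup>2) \<longleftrightarrow>
      cosh (\<kappa> * 1) = \<tau> * tanh \<tau> * (sinh (\<kappa> * 1) / \<kappa>) \<or>
      - \<kappa>\<^sup>2 * (sinh (\<kappa> * 1) / \<kappa>) + \<tau> * tanh \<tau> * cosh (\<kappa> * 1) = 0"
    by (rule linearized_eigenvalue_iff_off_bound_state
          [where C = "\<lambda>x. cosh (\<kappa> * x)" and S = "\<lambda>x. sinh (\<kappa> * x) / \<kappa>"])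
      (use assms ne in \<open>auto intro!: derivative_eq_intros simp: power2_eq_square\<close>)
  moreover have "- \<kappa>\<^sup>2 * (sinh (\<kappa> * 1) / \<kappa>) + \<tau> * tanh \<tau> * cosh (\<kappa> * 1) \<noteq> 0"
  proof
    assume "- \<kappa>\<^sup>2 * (sinh (\<kappa> * 1) / \<kappa>) + \<tau> * tanh \<tau> * cosh (\<kappa> * 1) = 0"
    then have "\<kappa> * tanh \<kappa> = \<tau> * tanh \<tau>"
      using assms by (simp add: tanh_def[of \<kappa>] field_simps power2_eq_square)
    moreover have "x * tanh x < y * tanh y" if "0 < x" "x < y" for x y :: real
      using that by (intro mult_strict_mono) auto
    ultimately show False
      using False assms by (metis less_irrefl linorder_neqE_linordered_idom)
  qed
  ultimately show ?thesis using assms by (simp add: field_simps)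
qed

text \<open>
  The first factor belongs to the even solution and the second to the odd one.
\<close>
lemma linearized_eigenvalue_positive_iff:
  assumes "\<tau> > 0" "k > 0"
  shows "linearized_eigenvalue \<tau> (k\<^sup>2) \<longleftrightarrow>
    (k * cos k - \<tau> * tanh \<tau> * sin k) * (k * sin k + \<tau> * tanh \<tau> * cos k) = 0"
proof -
  have ne: "k\<^sup>2 \<noteq> - \<tau>\<^sup>2"
    using assms by (smt (verit) zero_less_power)
  have "linearized_eigenvalue \<tau> (k\<^sup>2) \<longleftrightarrow>
      cos (k * 1) = \<tau> * tanh \<tau> * (sin (k * 1) / k) \<or>
      k\<^sup>2 * (sin (k * 1) / k) + \<tau> * tanh \<tau> * cos (k * 1) = 0"
    by (rule linearized_eigenvalue_iff_off_bound_state
          [where C = "\<lambda>x. cos (k * x)" and S = "\<lambda>x. sin (k * x) / k"])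
      (use assms ne in \<open>auto intro!: derivative_eq_intros simp: power2_eq_square\<close>)
  moreover have "cos (k * 1) = \<tau> * tanh \<tau> * (sin (k * 1) / k) \<longleftrightarrow>
      k * cos k - \<tau> * tanh \<tau> * sin k = 0"
    using assms(2) by (simp add: field_simps)
  moreover have "k\<^sup>2 * (sin (k * 1) / k) = k * sin k"
    using assms(2) by (simp add: power2_eq_square)
  ultimately show ?thesis by simp
qed

text \<open>
  With $k$ fixed in the coefficients, a shift of the trigonometric argument by $\pi/2$ turns each
  factor into the other up to sign, so all multiples of $\pi/2$ can be removed from the argument.
  On $[0, \pi/2)$ the second factor is positive.
\<close>
lemma quarter_turn_reduction:
  fixes a k s :: real
  assumes "a > 0" "k > 0" "k = real n * (pi / 2) + s" "0 \<le> s" "s < pi / 2"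
  shows "(k * cos k - a * sin k) * (k * sin k + a * cos k) = 0 \<longleftrightarrow> k * cos s = a * sin s"
proof -
  define P where "P \<theta> = (k * cos \<theta> - a * sin \<theta>) * (k * sin \<theta> + a * cos \<theta>)" for \<theta>
  have step: "P (\<theta> + pi / 2) = - P \<theta>" for \<theta>
    unfolding P_def by (simp add: sin_add cos_add algebra_simps)
  have "P (real n * (pi / 2) + s) = 0 \<longleftrightarrow> P s = 0"
  proof (induction n)
    case (Suc n)
    have "real (Suc n) * (pi / 2) + s = (real n * (pi / 2) + s) + pi / 2"
      by (simp add: algebra_simps add_divide_distrib)
    then have "P (real (Suc n) * (pi / 2) + s) = - P (real n * (pi / 2) + s)"
      by (simp only: step)
    then show ?case using Suc by simp
  qed simp
  moreover have "k * sin s + a * cos s > 0"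
    using assms by (intro add_nonneg_pos mult_pos_pos mult_nonneg_nonneg sin_ge_zero cos_gt_zero_pi) auto
  ultimately show ?thesis
    unfolding assms(3)[symmetric] P_def by auto
qed

lemma linearized_eigenvalue_positive_iff_band:
  assumes "\<tau> > 0" "m > 0"
  shows "linearized_eigenvalue \<tau> m \<longleftrightarrow>
    (\<exists>n::nat. \<exists>s. 0 < s \<and> s < pi / 2 \<and> m = (real n * (pi / 2) + s)\<^sup>2 \<and>
       (real n * (pi / 2) + s) * cos s = \<tau> * tanh \<tau> * sin s)"
proof
  have a: "\<tau> * tanh \<tau> > 0" using assms by simp
  define k where "k = sqrt m"
  have k: "k > 0" "m = k\<^sup>2" using assms by (auto simp: k_def)
  define n where "n = nat \<lfloor>k / (pi / 2)\<rfloor>"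
  define s where "s = k - real n * (pi / 2)"
  have n: "real n = of_int \<lfloor>k / (pi / 2)\<rfloor>" using k by (simp add: n_def)
  have "real n \<le> k / (pi / 2)" "k / (pi / 2) < real n + 1"
    unfolding n by linarith+
  then have s: "0 \<le> s" "s < pi / 2"
    unfolding s_def by (simp_all add: field_simps)
  have ks: "k = real n * (pi / 2) + s" by (simp add: s_def)
  assume "linearized_eigenvalue \<tau> m"
  then have eq: "k * cos s = \<tau> * tanh \<tau> * sin s"
    using linearized_eigenvalue_positive_iff[OF assms(1) k(1)] k(2)
      quarter_turn_reduction[OF a k(1) ks s] by simp
  moreover have "s \<noteq> 0" using eq k by auto
  ultimately show "\<exists>n::nat. \<exists>s. 0 < s \<and> s < pi / 2 \<and> m = (real n * (pi / 2) + s)\<^sup>2 \<and>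
       (real n * (pi / 2) + s) * cos s = \<tau> * tanh \<tau> * sin s"
    using s ks k(2) by (intro exI[of _ n] exI[of _ s]) auto
next
  have a: "\<tau> * tanh \<tau> > 0" using assms by simp
  assume "\<exists>n::nat. \<exists>s. 0 < s \<and> s < pi / 2 \<and> m = (real n * (pi / 2) + s)\<^sup>2 \<and>
       (real n * (pi / 2) + s) * cos s = \<tau> * tanh \<tau> * sin s"
  then obtain n :: nat and s where s: "0 < s" "s < pi / 2" "m = (real n * (pi / 2) + s)\<^sup>2"
    and eq: "(real n * (pi / 2) + s) * cos s = \<tau> * tanh \<tau> * sin s" by blast
  have k: "real n * (pi / 2) + s > 0" using s by (intro add_nonneg_pos) auto
  show "linearized_eigenvalue \<tau> m"
    unfolding s(3) linearized_eigenvalue_positive_iff[OF assms(1) k]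
    using quarter_turn_reduction[OF a k refl _ s(2)] s(1) eq by simp
qed

section \<open>The root of the band equation\<close>

text \<open>
  The function $x \mapsto (c + x) \cot x$ is strictly decreasing on $(0, \pi/2)$, because
  $\sin x \cos x < x \le c + x$.
\<close>
lemma band_root_unique:
  fixes a c s t :: real
  assumes "c \<ge> 0" "0 < s" "s < pi / 2" "0 < t" "t < pi / 2"
    and "(c + s) * cos s = a * sin s" "(c + t) * cos t = a * sin t"
  shows "s = t"
proof -
  define g where "g x = (c + x) * cos x / sin x" for x
  have anti: "g x > g y" if "0 < x" "x < y" "y < pi / 2" for x y
  proof (rule DERIV_neg_imp_decreasing[OF that(2)])
    fix z assume "x \<le> z" "z \<le> y"
    then have z: "0 < z" "z < pi / 2" using that by auto
    then have sn: "sin z > 0" by (intro sin_gt_zero) auto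
    have "cos z < 1" using cos_monotone_0_pi[of 0 z] z by simp
    then have "cos z * sin z < sin z" using sn by simp
    also have "sin z \<le> c + z" using sin_x_le_x[of z] z assms(1) by simp
    finally have "(cos z * sin z - (c + z)) / (sin z)\<^sup>2 < 0"
      using sn by (intro divide_neg_pos) auto
    moreover have "(cos z * sin z - (c + z) * ((cos z)\<^sup>2 + (sin z)\<^sup>2)) / (sin z)\<^sup>2
        = (cos z * sin z - (c + z)) / (sin z)\<^sup>2" by simp
    moreover have "(g has_real_derivative
        (cos z * sin z - (c + z) * ((cos z)\<^sup>2 + (sin z)\<^sup>2)) / (sin z)\<^sup>2) (at z)"
      unfolding g_def using sn
      by (auto intro!: derivative_eq_intros simp: algebra_simps power2_eq_square
          simp del: sin_cos_squared_add sin_cos_squared_add2 sin_cos_squared_add3)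
    ultimately show "\<exists>d. (g has_real_derivative d) (at z) \<and> d < 0"
      by metis
  qed
  have "g s = a" "g t = a"
    using assms sin_gt_zero[of s] sin_gt_zero[of t] by (auto simp: g_def field_simps)
  then show ?thesis using anti[of s t] anti[of t s] assms by (cases s t rule: linorder_cases) auto
qed


text \<open>
  The difference of the two sides is $- a < 0$ at $\pi/2$, so a point with positive difference
  suffices. For $c > 0$ the point $0$ will do. For $c = 0$ the difference vanishes at $0$, but any point at which
  the cosine exceeds $a$ works, because $a \sin r \le a r < r \cos r$.
\<close>
lemma band_root_exists:
  fixes a c :: real
  assumes "a > 0" "c > 0 \<or> c = 0 \<and> a < 1"
  shows "\<exists>s. 0 < s \<and> s < pi / 2 \<and> (c + s) * cos s = a * sin s"
proof -
  define h where "h s = (c + s) * cos s - a * sin s" for s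
  obtain r where r: "0 \<le> r" "r < pi / 2" "h r > 0"
  proof (cases "c > 0")
    case True
    then show ?thesis using that[of 0] by (simp add: h_def)
  next
    case False
    define r where "r = arccos ((1 + a) / 2)"
    have c: "c = 0" "a < 1" using False assms by auto
    have cosr: "cos r = (1 + a) / 2" unfolding r_def using assms c by (intro cos_arccos) auto
    have "arccos 1 < r" "r < arccos 0"
      unfolding r_def using assms c by (intro arccos_less_arccos; simp)+
    then have r: "0 < r" "r < pi / 2" by auto
    have "a * sin r \<le> a * r" using sin_x_le_x[of r] r assms by simp
    also have "\<dots> < r * cos r" unfolding cosr using r c by (simp add: mult.commute)
    finally show ?thesis using that[of r] r c by (simp add: h_def)
  qed
  have "\<exists>s. r \<le> s \<and> s \<le> pi / 2 \<and> h s = 0"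
    by (rule IVT2) (use r assms in \<open>auto simp: h_def intro!: continuous_intros\<close>)
  then obtain s where s: "r \<le> s" "s \<le> pi / 2" "h s = 0" by blast
  have "h (pi / 2) = - a" by (simp add: h_def)
  then have "s \<noteq> r" "s \<noteq> pi / 2"
    using s(3) r(3) assms(1) by (metis less_irrefl, metis less_irrefl neg_equal_0_iff_equal)
  then show ?thesis using s r by (intro exI[of _ s]) (auto simp: h_def)
qed

text \<open>
  From $a \sin s \le a (c + s)$ follows $\cos s \le a$: for small $a$ the root is close to $\pi/2$.
\<close>
lemma band_root_ge_arccos:
  fixes a c s :: real
  assumes "0 < a" "a < 1" "0 \<le> c" "0 < s" "s < pi / 2" "(c + s) * cos s = a * sin s"
  shows "arccos a \<le> s"
proof -
  have "(c + s) * cos s \<le> a * s"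
    using assms sin_x_le_x[of s] by simp
  also have "\<dots> \<le> (c + s) * a" using assms by (simp add: algebra_simps)
  finally have "cos s \<le> a" using assms(3,4) by (subst (asm) mult_le_cancel_left_pos) auto
  then have "arccos a \<le> arccos (cos s)"
    using assms cos_ge_minus_one[of s] by (intro arccos_le_arccos) auto
  then show ?thesis using assms by (simp add: arccos_cos)
qed

lemma mult_cos_less_sin:
  fixes x :: real
  assumes "0 < x" "x < pi"
  shows "x * cos x < sin x"
proof -
  obtain w where w: "0 < w" "w < x" "sin x - sin 0 = (x - 0) * cos w"
    using MVT2[OF assms(1), of sin cos] DERIV_sin by blast
  have "cos x < cos w" using w assms by (intro cos_monotone_0_pi) auto
  then show ?thesis using w assms by simp
qed

text \<open>
  From $s \cos s \le \sin s$ follows $a s \le c + s$: for large $a$ the root is close to $0$.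
\<close>
lemma band_root_le_inverse:
  fixes a c s :: real
  assumes "0 < a" "0 \<le> c" "0 < s" "s < pi / 2" "(c + s) * cos s = a * sin s"
  shows "s \<le> (c + pi / 2) / a"
proof -
  have cs: "cos s > 0" using assms by (intro cos_gt_zero_pi) auto
  have "s * cos s \<le> sin s" using mult_cos_less_sin[of s] assms by simp
  then have "a * (s * cos s) \<le> (c + s) * cos s"
    unfolding assms(5) using assms(1) by (intro mult_left_mono) auto
  then have "(a * s) * cos s \<le> (c + s) * cos s" by (simp add: mult.assoc)
  then have "a * s \<le> c + s" using cs by simp
  then show ?thesis using assms by (simp add: field_simps)
qed

section \<open>The negative eigenvalue\<close>

text \<open>
  By the mean value theorem $\sinh x = x \cosh w$ for some $w$ in $(0, x)$.
\<close>
lemma sinh_bounds: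
  fixes x :: real
  assumes "0 < x"
  shows "x < sinh x" "sinh x < x * cosh x"
proof -
  have "(sinh has_real_derivative cosh y) (at y)" for y :: real
    by (auto intro!: derivative_eq_intros)
  then obtain w where w: "0 < w" "w < x" "sinh x - sinh 0 = (x - 0) * cosh w"
    using MVT2[OF assms(1), of sinh cosh] by blast
  have "cosh 0 < cosh w" "cosh w < cosh x"
    using w cosh_real_strict_mono[of 0 w] cosh_real_strict_mono[of w x] by auto
  then show "x < sinh x" "sinh x < x * cosh x" using w assms by auto
qed

text \<open>
  The function $x \mapsto x \coth x$ is strictly increasing on $(0, \infty)$, because
  $x < \sinh x \le \sinh x \cosh x$.
\<close>
lemma hyperbolic_root_unique:
  fixes a x y :: real
  assumes "0 < x" "0 < y" "x * cosh x = a * sinh x" "y * cosh y = a * sinh y"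
  shows "x = y"
proof -
  define g where "g x = x * cosh x / sinh x" for x :: real
  have mono: "g x < g y" if "0 < x" "x < y" for x y
  proof (rule DERIV_pos_imp_increasing[OF that(2)])
    fix z assume "x \<le> z" "z \<le> y"
    then have z: "0 < z" using that by auto
    then have sn: "sinh z > 0" by simp
    have "z < sinh z" using sinh_bounds z by simp
    also have "sinh z \<le> cosh z * sinh z" using sn cosh_real_ge_1[of z] by simp
    finally have "(cosh z * sinh z - z * ((cosh z)\<^sup>2 - (sinh z)\<^sup>2)) / (sinh z)\<^sup>2 > 0"
      using sn by (simp add: cosh_square_eq)
    moreover have "(g has_real_derivative
        (cosh z * sinh z - z * ((cosh z)\<^sup>2 - (sinh z)\<^sup>2)) / (sinh z)\<^sup>2) (at z)"
      unfolding g_def using sn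
      by (auto intro!: derivative_eq_intros simp: algebra_simps power2_eq_square)
    ultimately show "\<exists>d. (g has_real_derivative d) (at z) \<and> d > 0"
      by metis
  qed
  have "g x = a" "g y = a"
    using assms by (auto simp: g_def field_simps)
  then show ?thesis using mono[of x y] mono[of y x] assms by (cases x y rule: linorder_cases) auto
qed

text \<open>
  The interval $[a - 1, a]$ brackets the root since $\kappa < \kappa \coth \kappa \le \kappa + 1$. The
  lower end of the bracket is what makes the lowest eigenvalue diverge.
\<close>
lemma hyperbolic_root_exists:
  fixes a :: real
  assumes "a > 1"
  shows "\<exists>\<kappa>. a - 1 \<le> \<kappa> \<and> 0 < \<kappa> \<and> \<kappa> * cosh \<kappa> = a * sinh \<kappa>"
proof -
  define h where "h x = x * cosh x - a * sinh x" for x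
  have "h (a - 1) \<le> 0"
  proof -
    have "cosh (a - 1) - sinh (a - 1) = exp (- (a - 1))"
      by (rule cosh_minus_sinh)
    then have "h (a - 1) = (a - 1) * exp (- (a - 1)) - sinh (a - 1)"
      by (simp add: h_def algebra_simps)
    also have "(a - 1) * exp (- (a - 1)) \<le> (a - 1) * 1"
      using assms by (intro mult_left_mono) auto
    also have "(a - 1) * 1 - sinh (a - 1) \<le> 0"
      using sinh_bounds(1)[of "a - 1"] assms by simp
    finally show ?thesis by simp
  qed
  moreover have "h a \<ge> 0"
    using assms sinh_le_cosh_real[of a] by (simp add: h_def)
  ultimately have "\<exists>x. a - 1 \<le> x \<and> x \<le> a \<and> h x = 0"
    by (intro IVT) (auto simp: h_def intro!: continuous_intros)
  then show ?thesis using assms by (force simp: h_def)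
qed

lemma hyperbolic_root_imp_gt_1:
  fixes a \<kappa> :: real
  assumes "\<kappa> > 0" "\<kappa> * cosh \<kappa> = a * sinh \<kappa>"
  shows "a > 1"
proof -
  have "1 * sinh \<kappa> < a * sinh \<kappa>" using sinh_bounds(2)[of \<kappa>] assms by simp
  then show ?thesis using assms(1) by (subst (asm) mult_less_cancel_right) auto
qed

lemma linearized_eigenvalue_nonpositive:
  assumes "\<tau> > 0" "m \<le> 0" "linearized_eigenvalue \<tau> m" "\<tau> * tanh \<tau> \<noteq> 1"
  obtains \<kappa> where "\<kappa> > 0" "m = - \<kappa>\<^sup>2" "\<kappa> * cosh \<kappa> = \<tau> * tanh \<tau> * sinh \<kappa>"
proof -
  have m: "m < 0" using assms linearized_eigenvalue_zero_iff[of \<tau>] by (cases "m = 0") auto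
  then have "sqrt (- m) > 0" "m = - (sqrt (- m))\<^sup>2" by auto
  with that[of "sqrt (- m)"] linearized_eigenvalue_negative_iff[of \<tau> "sqrt (- m)"] assms
  show ?thesis by simp
qed

section \<open>Locating the listed eigenvalues\<close>

text \<open>
  If the listings differed, then at the first such index the smaller of the two entries would have to
  occur in the other listing at an earlier index, where the listings agree.
\<close>
lemma strict_mono_listing_unique:
  fixes f g :: "nat \<Rightarrow> 'a::linorder"
  assumes "strict_mono_on {1..} f" "strict_mono_on {1..} g" "f ` {1..} = g ` {1..}" "j \<ge> 1"
  shows "f j = g j"
  using assms(4)
proof (induction j rule: less_induct)
  case (less j)
  have not_less: "\<not> f j < g j"
    if mono: "strict_mono_on {1..} f" "strict_mono_on {1..} g"
      and im: "f ` {1..} = g ` {1..}"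
      and IH: "\<And>i. i < j \<Longrightarrow> 1 \<le> i \<Longrightarrow> f i = g i" for f g :: "nat \<Rightarrow> 'a"
  proof
    assume lt: "f j < g j"
    obtain i where i: "i \<ge> 1" "f j = g i" using im less.prems by force
    then have "i < j" using lt mono(2) less.prems
      by (metis atLeast_iff linorder_cases order_less_imp_not_less strict_mono_onD)
    then have "f i = f j" using IH i by simp
    then show False using strict_mono_onD[OF mono(1), of i j] i \<open>i < j\<close> less.prems by simp
  qed
  show ?case
    using not_less[of f g] not_less[of g f] assms(1-3) less.IH by (metis linorder_neqE)
qed

text \<open>
  Every band $n \ge 1$ holds exactly one eigenvalue, whatever the size of $\tau \tanh \tau$. So the
  whole listing is known once the part of the spectrum below $(\pi/2)^2$ is known to be a single
  eigenvalue $e$. This treats both cases, $e > 0$ and $e < 0$, at once.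
\<close>
lemma listing_from_bands:
  assumes list: "lists_eigenvalues \<tau> m" and "\<tau> > 0"
    and first: "linearized_eigenvalue \<tau> e" "e < (pi / 2)\<^sup>2"
    and only: "\<And>c. linearized_eigenvalue \<tau> c \<Longrightarrow> c < (pi / 2)\<^sup>2 \<Longrightarrow> c = e"
  shows "m 1 = e"
    and "\<And>j. j \<ge> 2 \<Longrightarrow> \<exists>s. 0 < s \<and> s < pi / 2 \<and> m j = ((real j - 1) * (pi / 2) + s)\<^sup>2 \<and>
           ((real j - 1) * (pi / 2) + s) * cos s = \<tau> * tanh \<tau> * sin s"
proof -
  define a where "a = \<tau> * tanh \<tau>"
  have a: "a > 0" using assms(2) by (simp add: a_def)
  have "\<forall>n::nat. \<exists>s. n \<ge> 1 \<longrightarrow> 0 < s \<and> s < pi / 2 \<and>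
      (real n * (pi / 2) + s) * cos s = a * sin s"
  proof
    fix n :: nat
    show "\<exists>s. n \<ge> 1 \<longrightarrow> 0 < s \<and> s < pi / 2 \<and>
      (real n * (pi / 2) + s) * cos s = a * sin s"
      using band_root_exists[OF a, of "real n * (pi / 2)"] by (cases "n \<ge> 1") auto
  qed
  then obtain s where s: "\<And>n::nat. n \<ge> 1 \<Longrightarrow> 0 < s n \<and> s n < pi / 2 \<and>
      (real n * (pi / 2) + s n) * cos (s n) = a * sin (s n)" by metis
  \<comment> \<open>$K_n^2$ is the eigenvalue of band $n$, and $\nu$ is the explicit listing to compare with.\<close>
  define K where "K n = real n * (pi / 2) + s n" for n
  define \<nu> where "\<nu> j = (if j = 1 then e else (K (j - 1))\<^sup>2)" for j
  have K: "real n * (pi / 2) < K n" "K n < real (Suc n) * (pi / 2)" if "n \<ge> 1" for n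
    using s[OF that] by (auto simp: K_def algebra_simps add_divide_distrib)
  have K_mono: "K n < K n'" if "1 \<le> n" "n < n'" for n n'
  proof -
    have "K n < real (Suc n) * (pi / 2)" using K that by simp
    also have "\<dots> \<le> real n' * (pi / 2)" using that by (intro mult_right_mono) auto
    also have "\<dots> < K n'" using K that by simp
    finally show ?thesis .
  qed
  have K_low: "pi / 2 < K n" if "n \<ge> 1" for n
  proof -
    have "1 * (pi / 2) \<le> real n * (pi / 2)" using that by (intro mult_right_mono) auto
    then show ?thesis using K(1)[OF that] by linarith
  qed
  have sq_low: "(pi / 2)\<^sup>2 < (K n)\<^sup>2" if "n \<ge> 1" for n
    using K_low[OF that] by (intro power_strict_mono) auto
  have mono: "strict_mono_on {1..} \<nu>"
  proof (rule strict_mono_onI)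
    fix i j :: nat assume ij: "i \<in> {1..}" "j \<in> {1..}" "i < j"
    show "\<nu> i < \<nu> j"
    proof (cases "i = 1")
      case True
      then have "j - 1 \<ge> 1" using ij by simp
      from less_trans[OF first(2) sq_low[OF this]] True ij show ?thesis by (simp add: \<nu>_def)
    next
      case False
      then have n: "1 \<le> i - 1" "i - 1 < j - 1" using ij by auto
      have "0 \<le> K (i - 1)" using K_low[OF n(1)] pi_gt_zero by linarith
      with K_mono[OF n]
      have "(K (i - 1))\<^sup>2 < (K (j - 1))\<^sup>2" by (intro power_strict_mono) auto
      then show ?thesis using False ij by (simp add: \<nu>_def)
    qed
  qed
  have "\<nu> ` {1..} = {c. linearized_eigenvalue \<tau> c}"
  proof (intro equalityI subsetI)
    fix c assume "c \<in> \<nu> ` {1..}"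
    then obtain j where j: "j \<ge> 1" "c = \<nu> j" by auto
    show "c \<in> {c. linearized_eigenvalue \<tau> c}"
    proof (cases "j = 1")
      case False
      then have n: "j - 1 \<ge> 1" and c: "c = (K (j - 1))\<^sup>2" using j by (auto simp: \<nu>_def)
      have "c > 0" using sq_low[OF n] c by (smt (verit) zero_le_power2)
      then show ?thesis
        using linearized_eigenvalue_positive_iff_band[OF assms(2)] s[OF n] c
        unfolding a_def K_def by blast
    qed (use j first in \<open>auto simp: \<nu>_def\<close>)
  next
    fix c assume "c \<in> {c. linearized_eigenvalue \<tau> c}"
    then have c: "linearized_eigenvalue \<tau> c" by simp
    show "c \<in> \<nu> ` {1..}"
    proof (cases "c < (pi / 2)\<^sup>2")
      case True
      then show ?thesis using only[OF c] by (auto simp: \<nu>_def image_iff intro!: bexI[of _ 1])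
    next
      case False
      then have "c > 0" by (smt (verit) pi_half_gt_zero zero_less_power)
      then obtain n :: nat and r where r: "0 < r" "r < pi / 2" "c = (real n * (pi / 2) + r)\<^sup>2"
        "(real n * (pi / 2) + r) * cos r = a * sin r"
        using linearized_eigenvalue_positive_iff_band[OF assms(2)] c unfolding a_def by blast
      have n: "n \<ge> 1"
      proof (rule ccontr)
        assume "\<not> n \<ge> 1"
        then have "c = r\<^sup>2" using r by simp
        then show False using False r power_strict_mono[of r "pi / 2" 2] by simp
      qed
      have "r = s n"
        using band_root_unique[of "real n * (pi / 2)" r "s n" a] r s[OF n] by simp
      then have "c = \<nu> (Suc n)" using r n by (simp add: \<nu>_def K_def)
      then show ?thesis by auto
    qed
  qed
  then have eq: "m j = \<nu> j" if "j \<ge> 1" for j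
    using strict_mono_listing_unique[OF _ mono _ that, of m] list
    unfolding lists_eigenvalues_def by simp
  show "m 1 = e" using eq[of 1] by (simp add: \<nu>_def)
  fix j :: nat assume j: "j \<ge> 2"
  then have "real (j - 1) = real j - 1" by simp
  then show "\<exists>s. 0 < s \<and> s < pi / 2 \<and> m j = ((real j - 1) * (pi / 2) + s)\<^sup>2 \<and>
           ((real j - 1) * (pi / 2) + s) * cos s = \<tau> * tanh \<tau> * sin s"
    using eq[of j] s[of "j - 1"] j unfolding a_def
    by (intro exI[of _ "s (j - 1)"]) (auto simp: \<nu>_def K_def)
qed

text \<open>
  For $\tau \tanh \tau < 1$ the band $n = 0$ also has a root, and no eigenvalue is $\le 0$, since
  $\kappa \coth \kappa > 1$.
\<close>
lemma eigenvalue_in_band_subcritical: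
  assumes "lists_eigenvalues \<tau> m" "\<tau> > 0" "\<tau> * tanh \<tau> < 1" "j \<ge> 1"
  shows "\<exists>s. 0 < s \<and> s < pi / 2 \<and> m j = ((real j - 1) * (pi / 2) + s)\<^sup>2 \<and>
           ((real j - 1) * (pi / 2) + s) * cos s = \<tau> * tanh \<tau> * sin s"
proof -
  define a where "a = \<tau> * tanh \<tau>"
  have a: "0 < a" "a < 1" using assms by (auto simp: a_def)
  obtain s where s: "0 < s" "s < pi / 2" "(0 + s) * cos s = a * sin s"
    using band_root_exists[of a 0] a by blast
  have "linearized_eigenvalue \<tau> (s\<^sup>2)"
    unfolding a_def
    by (subst linearized_eigenvalue_positive_iff_band[OF assms(2)])
      (use s in \<open>auto simp: a_def intro!: exI[of _ "0::nat"] exI[of _ s]\<close>)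
  moreover have "s\<^sup>2 < (pi / 2)\<^sup>2" using s by (intro power_strict_mono) auto
  moreover have "c = s\<^sup>2" if c: "linearized_eigenvalue \<tau> c" "c < (pi / 2)\<^sup>2" for c
  proof -
    have "c > 0"
      using linearized_eigenvalue_nonpositive[OF assms(2) _ c(1)] hyperbolic_root_imp_gt_1 assms(3)
      by (metis less_irrefl less_asym not_less)
    then obtain n :: nat and r where r: "0 < r" "r < pi / 2" "c = (real n * (pi / 2) + r)\<^sup>2"
      "(real n * (pi / 2) + r) * cos r = a * sin r"
      using linearized_eigenvalue_positive_iff_band[OF assms(2)] c unfolding a_def by blast
    have "real n * (pi / 2) + r < pi / 2"
      using c(2) unfolding r(3) by (rule power_less_imp_less_base) simp
    then have "real n * (pi / 2) < 1 * (pi / 2)" using r(1) by linarith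
    then have n: "n = 0" by (simp only: mult_less_cancel_right_pos pi_half_gt_zero)
    show ?thesis using band_root_unique[of 0 r s a] r s n by simp
  qed
  ultimately have list: "m 1 = s\<^sup>2"
    "\<And>j. j \<ge> 2 \<Longrightarrow> \<exists>s. 0 < s \<and> s < pi / 2 \<and> m j = ((real j - 1) * (pi / 2) + s)\<^sup>2 \<and>
           ((real j - 1) * (pi / 2) + s) * cos s = \<tau> * tanh \<tau> * sin s"
    using listing_from_bands[OF assms(1,2), of "s\<^sup>2"] by blast+
  show ?thesis
  proof (cases "j = 1")
    case True
    then show ?thesis using list(1) s by (auto simp: a_def)
  qed (use list(2)[of j] assms(4) in auto)
qed

text \<open>
  For $\tau \tanh \tau > 1$ the band $n = 0$ has no root, since $r \cot r \le 1$. The lowest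
  eigenvalue is negative instead.
\<close>
lemma eigenvalue_bounds_supercritical:
  assumes "lists_eigenvalues \<tau> m" "\<tau> > 0" "\<tau> * tanh \<tau> > 1"
  shows "m 1 \<le> - (\<tau> * tanh \<tau> - 1)\<^sup>2"
    and "\<And>j. j \<ge> 2 \<Longrightarrow> \<exists>s. 0 < s \<and> s < pi / 2 \<and> m j = ((real j - 1) * (pi / 2) + s)\<^sup>2 \<and>
           ((real j - 1) * (pi / 2) + s) * cos s = \<tau> * tanh \<tau> * sin s"
proof -
  define a where "a = \<tau> * tanh \<tau>"
  have a: "a > 1" using assms by (auto simp: a_def)
  obtain \<kappa> where \<kappa>: "a - 1 \<le> \<kappa>" "0 < \<kappa>" "\<kappa> * cosh \<kappa> = a * sinh \<kappa>"
    using hyperbolic_root_exists[OF a] by blast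
  have "linearized_eigenvalue \<tau> (- \<kappa>\<^sup>2)"
    using linearized_eigenvalue_negative_iff[OF assms(2)] \<kappa> by (simp add: a_def)
  moreover have "- \<kappa>\<^sup>2 < (pi / 2)\<^sup>2"
    using \<kappa> by (smt (verit) zero_less_power zero_le_power2)
  moreover have "c = - \<kappa>\<^sup>2" if c: "linearized_eigenvalue \<tau> c" "c < (pi / 2)\<^sup>2" for c
  proof (cases "c > 0")
    case True
    then obtain n :: nat and r where r: "0 < r" "r < pi / 2" "c = (real n * (pi / 2) + r)\<^sup>2"
      "(real n * (pi / 2) + r) * cos r = a * sin r"
      using linearized_eigenvalue_positive_iff_band[OF assms(2)] c unfolding a_def by blast
    have "real n * (pi / 2) + r < pi / 2"
      using c(2) unfolding r(3) by (rule power_less_imp_less_base) simp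
    then have "real n * (pi / 2) < 1 * (pi / 2)" using r(1) by linarith
    then have n: "n = 0" by (simp only: mult_less_cancel_right_pos pi_half_gt_zero)
    have "r * cos r \<le> sin r" using mult_cos_less_sin[of r] r by simp
    also have "\<dots> < a * sin r" using a r sin_gt_zero[of r] by simp
    finally show ?thesis using r n by simp
  next
    case False
    then obtain y where "y > 0" "c = - y\<^sup>2" "y * cosh y = a * sinh y"
      using linearized_eigenvalue_nonpositive[OF assms(2) _ c(1)] assms(3) unfolding a_def by auto
    then show ?thesis using hyperbolic_root_unique[of y \<kappa> a] \<kappa> by simp
  qed
  ultimately have m1: "m 1 = - \<kappa>\<^sup>2"
    and "\<And>j. j \<ge> 2 \<Longrightarrow> \<exists>s. 0 < s \<and> s < pi / 2 \<and> m j = ((real j - 1) * (pi / 2) + s)\<^sup>2 \<and>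
           ((real j - 1) * (pi / 2) + s) * cos s = \<tau> * tanh \<tau> * sin s"
    using listing_from_bands[OF assms(1,2), of "- \<kappa>\<^sup>2"] by blast+
  then show "\<And>j. j \<ge> 2 \<Longrightarrow> \<exists>s. 0 < s \<and> s < pi / 2 \<and> m j = ((real j - 1) * (pi / 2) + s)\<^sup>2 \<and>
           ((real j - 1) * (pi / 2) + s) * cos s = \<tau> * tanh \<tau> * sin s" by blast
  show "m 1 \<le> - (\<tau> * tanh \<tau> - 1)\<^sup>2"
    unfolding m1 using \<kappa> a by (fold a_def) (auto intro!: power_mono)
qed

theorem corollary1p3:
  fixes \<mu> :: "real \<Rightarrow> nat \<Rightarrow> real"
  assumes "\<And>\<tau>. \<tau> > 0 \<Longrightarrow> lists_eigenvalues \<tau> (\<mu> \<tau>)"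
  shows "(\<forall>j\<ge>1. ((\<lambda>\<tau>. sqrt (\<mu> \<tau> j)) \<longlongrightarrow> pi / 2 * real j) (at_right 0)) \<and>
         filterlim (\<lambda>\<tau>. \<mu> \<tau> 1) at_bot at_top \<and>
         (\<forall>j\<ge>2. ((\<lambda>\<tau>. sqrt (\<mu> \<tau> j)) \<longlongrightarrow> pi / 2 * (real j - 1)) at_top)"
proof (intro conjI allI impI)
  define a where "a = (\<lambda>\<tau>::real. \<tau> * tanh \<tau>)"
  have "(a \<longlongrightarrow> a 0) (at_right 0)"
    unfolding a_def by (intro tendsto_intros) auto
  then have a0: "(a \<longlongrightarrow> 0) (at_right 0)" by (simp add: a_def)
  have a_top: "filterlim a at_top at_top"
    unfolding a_def
    by (rule filterlim_at_top_mult_tendsto_pos[OF tanh_real_at_top _ filterlim_ident]) simp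
  {
    fix j :: nat assume j: "j \<ge> 1"
    define c where "c = (real j - 1) * (pi / 2)"
    have c: "c \<ge> 0" using j by (simp add: c_def)
    have "\<forall>\<^sub>F \<tau> in at_right 0. a \<tau> < 1" using a0 by (rule order_tendstoD) simp
    moreover have "\<forall>\<^sub>F \<tau> in at_right (0::real). \<tau> > 0"
      by (rule eventually_at_right_less)
    ultimately have ev: "\<forall>\<^sub>F \<tau> in at_right 0. c + arccos (a \<tau>) \<le> sqrt (\<mu> \<tau> j) \<and>
        sqrt (\<mu> \<tau> j) \<le> c + pi / 2"
    proof eventually_elim
      case (elim \<tau>)
      then obtain s where s: "0 < s" "s < pi / 2" "\<mu> \<tau> j = (c + s)\<^sup>2" "(c + s) * cos s = a \<tau> * sin s"
        using eigenvalue_in_band_subcritical[OF assms, of \<tau> j] j unfolding c_def a_def by auto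
      have "a \<tau> > 0" using elim by (simp add: a_def)
      then have "arccos (a \<tau>) \<le> s" using band_root_ge_arccos[OF _ _ c s(1,2,4)] elim by simp
      then show ?case using s c by simp
    qed
    have "isCont arccos 0" by (rule isCont_arccos) simp_all
    then have "((\<lambda>\<tau>. arccos (a \<tau>)) \<longlongrightarrow> arccos 0) (at_right 0)"
      using a0 by (rule isCont_tendsto_compose)
    then have "((\<lambda>\<tau>. c + arccos (a \<tau>)) \<longlongrightarrow> c + pi / 2) (at_right 0)"
      unfolding arccos_0 by (rule tendsto_add[OF tendsto_const])
    from tendsto_sandwich[OF _ _ this tendsto_const]
    have "((\<lambda>\<tau>. sqrt (\<mu> \<tau> j)) \<longlongrightarrow> c + pi / 2) (at_right 0)"
      using ev by (simp add: eventually_conj_iff)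
    moreover have "c + pi / 2 = pi / 2 * real j" by (simp add: c_def field_simps)
    ultimately show "((\<lambda>\<tau>. sqrt (\<mu> \<tau> j)) \<longlongrightarrow> pi / 2 * real j) (at_right 0)"
      by simp
  next
    \<comment> \<open>For $a \ge 3$ one has $(a - 1)^2 \ge a$, so $- \mu_1$ dominates $a$.\<close>
    have "\<forall>\<^sub>F \<tau> in at_top. a \<tau> > 3 \<and> \<tau> > 0"
      using a_top eventually_gt_at_top[of "0::real"]
      unfolding filterlim_at_top_dense by (simp add: eventually_conj)
    then have "\<forall>\<^sub>F \<tau> in at_top. a \<tau> \<le> - \<mu> \<tau> 1"
    proof eventually_elim
      case (elim \<tau>)
      then have "\<mu> \<tau> 1 \<le> - (a \<tau> - 1)\<^sup>2"
        using eigenvalue_bounds_supercritical(1)[OF assms, of \<tau>] by (simp add: a_def)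
      moreover have "3 * a \<tau> \<le> a \<tau> * a \<tau>" using elim by (intro mult_right_mono) auto
      ultimately show ?case by (simp add: power2_eq_square algebra_simps)
    qed
    with a_top have "filterlim (\<lambda>\<tau>. - \<mu> \<tau> 1) at_top at_top"
      by (rule filterlim_at_top_mono)
    then show "filterlim (\<lambda>\<tau>. \<mu> \<tau> 1) at_bot at_top"
      by (simp add: filterlim_uminus_at_bot)
  next
    fix j :: nat assume j: "j \<ge> 2"
    define c where "c = (real j - 1) * (pi / 2)"
    have c: "c \<ge> 0" using j by (simp add: c_def)
    have ev: "\<forall>\<^sub>F \<tau> in at_top. a \<tau> > 1 \<and> \<tau> > 0"
      using a_top eventually_gt_at_top[of "0::real"]
      unfolding filterlim_at_top_dense by (simp add: eventually_conj)
    then have ev: "\<forall>\<^sub>F \<tau> in at_top. c \<le> sqrt (\<mu> \<tau> j) \<and>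
        sqrt (\<mu> \<tau> j) \<le> c + (c + pi / 2) / a \<tau>"
    proof eventually_elim
      case (elim \<tau>)
      then obtain s where s: "0 < s" "s < pi / 2" "\<mu> \<tau> j = (c + s)\<^sup>2" "(c + s) * cos s = a \<tau> * sin s"
        using eigenvalue_bounds_supercritical(2)[OF assms, of \<tau> j] j unfolding c_def a_def by auto
      have "s \<le> (c + pi / 2) / a \<tau>" using band_root_le_inverse[OF _ c s(1,2,4)] elim by simp
      then show ?case using s c by simp
    qed
    have "((\<lambda>\<tau>. (c + pi / 2) / a \<tau>) \<longlongrightarrow> 0) at_top"
      by (rule tendsto_divide_0[OF tendsto_const filterlim_at_top_imp_at_infinity[OF a_top]])
    then have "((\<lambda>\<tau>. c + (c + pi / 2) / a \<tau>) \<longlongrightarrow> c + 0) at_top"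
      by (rule tendsto_add[OF tendsto_const])
    then have "((\<lambda>\<tau>. c + (c + pi / 2) / a \<tau>) \<longlongrightarrow> c) at_top" by simp
    from tendsto_sandwich[OF _ _ tendsto_const this]
    have "((\<lambda>\<tau>. sqrt (\<mu> \<tau> j)) \<longlongrightarrow> c) at_top"
      using ev by (simp add: eventually_conj_iff)
    then show "((\<lambda>\<tau>. sqrt (\<mu> \<tau> j)) \<longlongrightarrow> pi / 2 * (real j - 1)) at_top"
      by (simp add: c_def mult.commute)
  }
qed

end
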